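(* Let $\chi:\mathbb{R}^{2d}\to\mathbb{R}^{2d}$ be the linear map given by a symplectic matrix $$\begin{pmatrix}A&B\\ C&D\end{pmatrix}\in Sp(d,\mathbb{R})$$ with $d\times d$ blocks. Then the following are equivalent: (1) $\chi$ satisfies the vertical nonrefocusing condition; (2) there exists $\varepsilon>0$ such that $|B\eta|\ge\varepsilon|D\eta|$ for all $\eta\in\mathbb{R}^d$; (3) $\det B\ne0$.
   Context: $Sp(d,\mathbb{R})$ is the group of real $2d\times2d$ symplectic matrices, acting on column vectors $(y,\eta)\in\mathbb{R}^d\times\mathbb{R}^d$, so that $\chi(0,\eta)=(B\eta,D\eta)$. Vertical nonrefocusing condition for a map $\chi$: there exist an open conic neighborhood $\Gamma\subset\mathbb{R}^{2d}\setminus\{0\}$ of $\{0\}\times(\mathbb{R}^d\setminus\{0\})$ and $R>0$ such that, for $\eta\in\mathbb{R}^d$, $|\eta|>R$ implies $\chi(0,\eta)\notin\Gamma$. (Conic means invariant under multiplication by positive scalars.) *)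

theory Defs
  imports "HOL-Analysis.Analysis"
begin

text \<open>The space of column vectors \<open>(y, \<eta>)\<close> with \<open>y\<close> and \<open>\<eta>\<close> in \<open>real ^ 'd\<close> is
  \<open>real ^ ('d + 'd)\<close>: the index \<open>Inl i\<close> is the \<open>i\<close>-th coordinate of \<open>y\<close>, and \<open>Inr i\<close> is the
  \<open>i\<close>-th coordinate of \<open>\<eta>\<close>.\<close>

definition join_vec :: "real ^ 'd \<Rightarrow> real ^ 'd \<Rightarrow> real ^ ('d + 'd)" where
  "join_vec y \<eta> = (\<chi> k. case k of Inl i \<Rightarrow> y $ i | Inr i \<Rightarrow> \<eta> $ i)"

definition block_matrix ::
  "real ^ 'd ^ 'd \<Rightarrow> real ^ 'd ^ 'd \<Rightarrow> real ^ 'd ^ 'd \<Rightarrow> real ^ 'd ^ 'd \<Rightarrow> real ^ ('d + 'd) ^ ('d + 'd)"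
where
  "block_matrix A B C D =
     (\<chi> k. case k of Inl i \<Rightarrow> join_vec (A $ i) (B $ i) | Inr i \<Rightarrow> join_vec (C $ i) (D $ i))"

definition symplectic_form_matrix :: "real ^ ('d::finite + 'd) ^ ('d + 'd)" where
  "symplectic_form_matrix = block_matrix 0 (mat 1) (- mat 1) 0"

definition symplectic :: "real ^ ('d::finite + 'd) ^ ('d + 'd) \<Rightarrow> bool" where
  "symplectic M \<longleftrightarrow> transpose M ** symplectic_form_matrix ** M = symplectic_form_matrix"

text \<open>Only positive scalars are used, so the library's \<open>cone\<close> (which allows the scalar 0) does not
  apply.\<close>

definition conic :: "'a::real_vector set \<Rightarrow> bool" where
  "conic \<Gamma> \<longleftrightarrow> (\<forall>x\<in>\<Gamma>. \<forall>t>0. t *\<^sub>R x \<in> \<Gamma>)"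

definition vertical_nonrefocusing :: "(real ^ ('d::finite + 'd) \<Rightarrow> real ^ ('d + 'd)) \<Rightarrow> bool" where
  "vertical_nonrefocusing f \<longleftrightarrow>
     (\<exists>\<Gamma> R. open \<Gamma> \<and> conic \<Gamma> \<and> \<Gamma> \<subseteq> UNIV - {0} \<and> {join_vec 0 \<eta> |\<eta>. \<eta> \<noteq> 0} \<subseteq> \<Gamma> \<and> R > 0 \<and>
        (\<forall>\<eta>. norm \<eta> > R \<longrightarrow> f (join_vec 0 \<eta>) \<notin> \<Gamma>))"

lemma block_matrix_mult_join_vec:
  fixes A B C D :: "real ^ 'd::finite ^ 'd"
  shows "block_matrix A B C D *v join_vec y \<eta> = join_vec (A *v y + B *v \<eta>) (C *v y + D *v \<eta>)"
proof -
  have *: "(\<Sum>k\<in>UNIV. h k) = (\<Sum>i\<in>UNIV. h (Inl i)) + (\<Sum>i\<in>UNIV. h (Inr i))"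
    for h :: "'d + 'd \<Rightarrow> real"
    unfolding UNIV_Plus_UNIV[symmetric] by (subst sum.Plus) (auto simp: o_def)
  show ?thesis
    by (auto simp: vec_eq_iff block_matrix_def join_vec_def matrix_vector_mult_def * split: sum.splits)
qed

end

theory Submission
  imports Defs
begin

text \<open>A symplectic matrix is injective, so \<open>B\<close> and \<open>D\<close> have no common kernel vector. If
  \<open>B \<eta> = 0\<close> with \<open>\<eta> \<noteq> 0\<close>, then \<open>(0, \<eta>)\<close> is sent to the nonzero vertical vector \<open>(0, D \<eta>)\<close>,
  and \<open>\<eta>\<close> can be scaled to have arbitrarily large norm. The nonrefocusing condition excludes this,
  so it forces \<open>B\<close> to be invertible.

  For invertible \<open>B\<close> the map \<open>D B\<^sup>-\<^sup>1\<close> is bounded, which is the estimate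
  \<open>\<bar>B \<eta>\<bar> \<ge> \<epsilon> \<bar>D \<eta>\<bar>\<close>. The estimate in turn says exactly that the image of the vertical space
  avoids the cone \<open>\<bar>y\<bar> < \<epsilon> \<bar>\<eta>\<bar>\<close>, an open conic neighborhood of the nonzero vertical vectors;
  this is the nonrefocusing condition and closes the cycle.\<close>

lemma join_vec_eq_iff [simp]: "join_vec y \<eta> = join_vec y' \<eta>' \<longleftrightarrow> y = y' \<and> \<eta> = \<eta>'"
  by (auto simp: join_vec_def vec_eq_iff split: sum.splits)

lemma join_vec_0 [simp]: "join_vec 0 0 = 0"
  by (auto simp: join_vec_def vec_eq_iff split: sum.splits)

text \<open>From \<open>M x = 0\<close> it follows that \<open>J x = M\<^sup>T J M x = 0\<close>, and \<open>J\<close> only swaps the two halves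
  of \<open>x\<close> up to sign.\<close>

lemma symplectic_vertical_kernel:
  fixes A B C D :: "real ^ 'd::finite ^ 'd"
  assumes sym: "symplectic (block_matrix A B C D)"
    and B: "B *v \<eta> = 0" and D: "D *v \<eta> = 0"
  shows "\<eta> = 0"
proof -
  let ?M = "block_matrix A B C D" and ?J = "symplectic_form_matrix :: real ^ ('d + 'd) ^ ('d + 'd)"
  have M: "?M *v join_vec 0 \<eta> = 0"
    by (simp add: block_matrix_mult_join_vec B D)
  have "join_vec \<eta> 0 = ?J *v join_vec 0 \<eta>"
    by (simp add: symplectic_form_matrix_def block_matrix_mult_join_vec)
  also have "\<dots> = (transpose ?M ** ?J ** ?M) *v join_vec 0 \<eta>"
    using sym by (simp add: symplectic_def)
  also have "\<dots> = (transpose ?M ** ?J) *v (?M *v join_vec 0 \<eta>)"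
    by (simp only: matrix_vector_mul_assoc)
  also have "\<dots> = join_vec 0 0"
    by (simp add: M)
  finally show "\<eta> = 0"
    by (simp only: join_vec_eq_iff)
qed

lemma det_eq_0_kernel:
  fixes B :: "real ^ 'd::finite ^ 'd"
  assumes "det B = 0"
  obtains \<eta> where "\<eta> \<noteq> 0" "B *v \<eta> = 0"
proof -
  have "\<not> (\<exists>B'. B' ** B = mat 1)"
    using assms invertible_det_nz[of B] invertible_left_inverse[of B] by simp
  then show ?thesis
    using that matrix_left_invertible_ker[of B] by blast
qed

text \<open>The cone \<open>\<bar>y\<bar> < \<epsilon> \<bar>\<eta>\<bar>\<close> serves as the neighborhood of the vertical vectors. The estimate
  holds for every \<open>\<eta>\<close>, not only for large ones, so the choice of \<open>R\<close> is arbitrary.\<close>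

lemma vertical_nonrefocusing_if_estimate:
  fixes A B C D :: "real ^ 'd::finite ^ 'd"
  assumes "\<epsilon> > 0" and est: "\<And>\<eta>. norm (B *v \<eta>) \<ge> \<epsilon> * norm (D *v \<eta>)"
  shows "vertical_nonrefocusing (\<lambda>x. block_matrix A B C D *v x)"
proof -
  define p q :: "real ^ ('d + 'd) \<Rightarrow> real ^ 'd"
    where "p x = (\<chi> i. x $ Inl i)" and "q x = (\<chi> i. x $ Inr i)" for x
  have join: "p (join_vec y \<eta>) = y" "q (join_vec y \<eta>) = \<eta>" for y \<eta>
    by (auto simp: p_def q_def join_vec_def)
  have scale: "p (t *\<^sub>R x) = t *\<^sub>R p x" "q (t *\<^sub>R x) = t *\<^sub>R q x" for t x
    by (auto simp: p_def q_def vec_eq_iff)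
  have zero: "p 0 = 0" "q 0 = 0"
    by (auto simp: p_def q_def vec_eq_iff)
  let ?\<Gamma> = "{x. norm (p x) < \<epsilon> * norm (q x)}"
  have "open ?\<Gamma>"
    unfolding p_def q_def by (intro open_Collect_less continuous_intros)
  moreover have "conic ?\<Gamma>"
    by (auto simp: conic_def scale mult.left_commute[of \<epsilon>])
  moreover have "?\<Gamma> \<subseteq> UNIV - {0}"
    by (auto simp: zero)
  moreover have "{join_vec 0 \<eta> |\<eta>. \<eta> \<noteq> 0} \<subseteq> ?\<Gamma>"
    using \<open>\<epsilon> > 0\<close> by (auto simp: join)
  moreover have "block_matrix A B C D *v join_vec 0 \<eta> \<notin> ?\<Gamma>" for \<eta>
    using est[of \<eta>] by (simp add: block_matrix_mult_join_vec join)
  ultimately show ?thesis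
    unfolding vertical_nonrefocusing_def by (intro exI[of _ ?\<Gamma>] exI[of _ 1]) simp
qed

lemma det_nonzero_if_vertical_nonrefocusing:
  fixes A B C D :: "real ^ 'd::finite ^ 'd"
  assumes sym: "symplectic (block_matrix A B C D)"
    and "vertical_nonrefocusing (\<lambda>x. block_matrix A B C D *v x)"
  shows "det B \<noteq> 0"
proof
  assume "det B = 0"
  then obtain v where v: "v \<noteq> 0" "B *v v = 0"
    by (rule det_eq_0_kernel)
  obtain \<Gamma> R where vert: "{join_vec 0 \<eta> |\<eta>. \<eta> \<noteq> 0} \<subseteq> \<Gamma>" and "R > 0"
    and avoid: "\<And>\<eta>. norm \<eta> > R \<Longrightarrow> block_matrix A B C D *v join_vec 0 \<eta> \<notin> \<Gamma>"
    using assms(2) unfolding vertical_nonrefocusing_def by auto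
  define \<eta> where "\<eta> = ((R + 1) / norm v) *\<^sub>R v"
  have "norm \<eta> > R" and "\<eta> \<noteq> 0" and B: "B *v \<eta> = 0"
    using v \<open>R > 0\<close> by (auto simp: \<eta>_def matrix_vector_mult_scaleR)
  then have "D *v \<eta> \<noteq> 0"
    using symplectic_vertical_kernel[OF sym] by blast
  then have "block_matrix A B C D *v join_vec 0 \<eta> \<in> \<Gamma>"
    using vert by (auto simp: block_matrix_mult_join_vec B)
  with avoid[OF \<open>norm \<eta> > R\<close>] show False ..
qed

lemma estimate_if_det_nonzero:
  fixes B D :: "real ^ 'd::finite ^ 'd"
  assumes "det B \<noteq> 0"
  shows "\<exists>\<epsilon>>0. \<forall>\<eta>. norm (B *v \<eta>) \<ge> \<epsilon> * norm (D *v \<eta>)"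
proof -
  obtain B' where B': "B' ** B = mat 1"
    using assms invertible_det_nz[of B] invertible_left_inverse[of B] by auto
  obtain K where "K > 0" and K: "\<And>x. norm ((D ** B') *v x) \<le> norm x * K"
    using bounded_linear.pos_bounded[OF matrix_vector_mul_bounded_linear[of "D ** B'"]] by blast
  have "(1 / K) * norm (D *v \<eta>) \<le> norm (B *v \<eta>)" for \<eta>
  proof -
    have "(D ** B') *v (B *v \<eta>) = D *v \<eta>"
      by (simp add: matrix_vector_mul_assoc matrix_mul_assoc[symmetric] B')
    with K[of "B *v \<eta>"] \<open>K > 0\<close> show ?thesis
      by (simp add: field_simps)
  qed
  with \<open>K > 0\<close> show ?thesis
    by (intro exI[of _ "1 / K"]) simp
qed

theorem mainTheorem4:
  fixes A B C D :: "real ^ 'd::finite ^ 'd"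
  assumes "symplectic (block_matrix A B C D)"
  shows "(vertical_nonrefocusing (\<lambda>x. block_matrix A B C D *v x) \<longleftrightarrow>
            (\<exists>\<epsilon>>0. \<forall>\<eta>. norm (B *v \<eta>) \<ge> \<epsilon> * norm (D *v \<eta>)))
       \<and> ((\<exists>\<epsilon>>0. \<forall>\<eta>. norm (B *v \<eta>) \<ge> \<epsilon> * norm (D *v \<eta>)) \<longleftrightarrow> det B \<noteq> 0)"
proof -
  let ?V = "vertical_nonrefocusing (\<lambda>x. block_matrix A B C D *v x)"
  let ?E = "\<exists>\<epsilon>>0. \<forall>\<eta>. norm (B *v \<eta>) \<ge> \<epsilon> * norm (D *v \<eta>)"
  have "?E \<Longrightarrow> ?V"
    by (elim exE conjE) (rule vertical_nonrefocusing_if_estimate, auto)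
  moreover have "?V \<Longrightarrow> det B \<noteq> 0"
    by (rule det_nonzero_if_vertical_nonrefocusing[OF assms])
  moreover have "det B \<noteq> 0 \<Longrightarrow> ?E"
    by (rule estimate_if_det_nonzero)
  ultimately show ?thesis
    by argo
qed

end
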